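(* For $q\geq 3$ and $2\leq k-1\leq \frac{q}{3+\log q}$ (logarithm to base $2$), $\mathcal{T}^k_q\subsetneq \mathcal{TW}_{k-1}\cap\mathcal{TD}_q$, and $\mathcal{T}^2_q\subsetneq\mathcal{TW}_1\cap\mathcal{TD}_q$.
   Context: Graphs are finite, simple, undirected. A rooted forest is viewed as a partial order $\preceq$ on its vertices (ancestor relation, roots minimal); its height is the number of vertices of a longest chain. $\mathcal{TW}_{k}$ is the class of graphs of treewidth at most $k$; $\mathcal{TD}_q$ is the class of graphs of treedepth at most $q$ (minimum height of a rooted forest $F$ on $V(G)$ such that every edge of $G$ joins $\preceq$-comparable vertices). A $k$-pebble forest cover of a graph $G$ is a rooted forest $(F,\preceq)$ on $V(G)$ together with $p\colon V(G)\to[k]$ such that every edge $uv\in E(G)$ has $u\preceq v$ or $v\preceq u$, and whenever $uv\in E(G)$ and $u\prec v$, every $w$ with $u\prec w\preceq v$ satisfies $p(w)\neq p(u)$. Its depth is the height of the forest. $\mathcal{T}^k_q$ is the class of graphs admitting a $k$-pebble forest cover of depth at most $q$. *)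

theory Defs
  imports Complex_Main "Graph_Theory.Pair_Digraph" "Graph_Theory.Digraph_Component"
begin

text \<open>
  Finite simple undirected graphs are the \<^locale>\<open>pair_graph\<close>s: finite vertex set, and a symmetric
  irreflexive arc relation, so that an edge \<open>uv\<close> is represented by the two arcs \<open>(u, v)\<close> and \<open>(v, u)\<close>.
\<close>

text \<open>
  A rooted forest is given by its ancestor relation \<open>r\<close>, with \<open>(u, v) \<in> r\<close> iff \<open>u\<close> is an ancestor of
  \<open>v\<close> or equal to it. The ancestor relations of finite rooted forests are the finite partial orders in
  which the elements below any given element form a chain; the roots are the minimal elements.
\<close>

definition rooted_forest :: "'a set \<Rightarrow> 'a rel \<Rightarrow> bool" where
  "rooted_forest V r \<longleftrightarrow>
     finite V \<and> partial_order_on V r \<and> (\<forall>v\<in>V. {u. (u, v) \<in> r} \<in> Chains r)"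

definition forest_height :: "'a rel \<Rightarrow> nat" where
  "forest_height r = Max (card ` Chains r)"

definition forest_cover :: "'a pair_pre_digraph \<Rightarrow> 'a rel \<Rightarrow> bool" where
  "forest_cover G r \<longleftrightarrow>
     rooted_forest (pverts G) r \<and> (\<forall>(u, v)\<in>parcs G. (u, v) \<in> r \<or> (v, u) \<in> r)"

definition treedepth :: "'a pair_pre_digraph \<Rightarrow> nat" where
  "treedepth G = (LEAST d. \<exists>r. forest_cover G r \<and> forest_height r = d)"

definition pebble_forest_cover ::
    "nat \<Rightarrow> 'a pair_pre_digraph \<Rightarrow> 'a rel \<Rightarrow> ('a \<Rightarrow> nat) \<Rightarrow> bool" where
  "pebble_forest_cover k G r p \<longleftrightarrow>
     forest_cover G r \<and> p ` pverts G \<subseteq> {1..k} \<and>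
     (\<forall>(u, v)\<in>parcs G. (u, v) \<in> r \<longrightarrow>
        (\<forall>w. (u, w) \<in> r \<and> u \<noteq> w \<and> (w, v) \<in> r \<longrightarrow> p w \<noteq> p u))"

text \<open>
  The constant \<^const>\<open>tree\<close> excludes directed cycles only: it rejects every symmetric graph with an
  edge, because \<open>u, v, u\<close> counts as a cycle, and it accepts acyclic orientations of a triangle. In a
  simple undirected graph the cycles in the usual sense are the ones of length at least 3.
\<close>

definition undirected_tree :: "'b pair_pre_digraph \<Rightarrow> bool" where
  "undirected_tree T \<longleftrightarrow>
     pair_graph T \<and> connected (with_proj T) \<and>
     \<not> (\<exists>c. pre_digraph.cycle (with_proj T) c \<and> length c \<ge> 3)"

text \<open>
  \<^const>\<open>connected\<close> includes nonemptiness, so the last conjunct below also says that every vertex lies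
  in some bag.
\<close>

definition tree_decomposition ::
    "'a pair_pre_digraph \<Rightarrow> 'b pair_pre_digraph \<Rightarrow> ('b \<Rightarrow> 'a set) \<Rightarrow> bool" where
  "tree_decomposition G T B \<longleftrightarrow>
     undirected_tree T \<and>
     (\<forall>t\<in>pverts T. B t \<subseteq> pverts G) \<and>
     (\<forall>(u, v)\<in>parcs G. \<exists>t\<in>pverts T. u \<in> B t \<and> v \<in> B t) \<and>
     (\<forall>v\<in>pverts G. connected (induce_subgraph (with_proj T) {t \<in> pverts T. v \<in> B t}))"

text \<open>
  The truncated subtraction only affects the graph without vertices, which gets treewidth 0.
\<close>

definition decomposition_width :: "'b pair_pre_digraph \<Rightarrow> ('b \<Rightarrow> 'a set) \<Rightarrow> nat" where
  "decomposition_width T B = Max ((\<lambda>t. card (B t)) ` pverts T) - 1"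

text \<open>
  Every finite tree is isomorphic to one whose nodes are natural numbers, so it suffices to consider
  decompositions along such trees.
\<close>

definition treewidth :: "'a pair_pre_digraph \<Rightarrow> nat" where
  "treewidth G =
     (LEAST w. \<exists>(T :: nat pair_pre_digraph) B.
        tree_decomposition G T B \<and> decomposition_width T B = w)"

text \<open>
  The classes collect the graphs whose vertices are drawn from a fixed type. If that type is infinite,
  every finite graph has an isomorphic copy on it.
\<close>

definition TW :: "nat \<Rightarrow> 'a pair_pre_digraph set" where
  "TW k = {G. pair_graph G \<and> treewidth G \<le> k}"

definition TD :: "nat \<Rightarrow> 'a pair_pre_digraph set" where
  "TD q = {G. pair_graph G \<and> treedepth G \<le> q}"

definition PFC :: "nat \<Rightarrow> nat \<Rightarrow> 'a pair_pre_digraph set" where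
  "PFC k q =
     {G. pair_graph G \<and> (\<exists>r p. pebble_forest_cover k G r p \<and> forest_height r \<le> q)}"

end

theory Submission
  imports Defs
begin

text \<open>
  Inclusion: let the bag of \<open>v\<close> consist of the ancestors \<open>u\<close> of \<open>v\<close> whose pebble is not used again
  between \<open>u\<close> and \<open>v\<close>. The forest with an additional root is a tree decomposition with these bags.

  Strictness: the witness is the \<open>h\<close>-th power of a path on \<open>N = h (2\<^sup>m - 1)\<close> vertices, where \<open>h = k - 1\<close>.
  Eliminating middle blocks of \<open>h\<close> consecutive vertices gives treedepth at most \<open>h m\<close>. With only
  \<open>h + 1\<close> pebbles, however, each window \<open>{i..i + h}\<close> uses up all of them. If its last vertex is not
  \<open>i\<close>, then the pebble on \<open>i\<close> is the one that moves on to \<open>i + h + 1\<close>, so this vertex comes below the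
  whole window and the situation repeats at \<open>i + 1\<close>. Hence, for some \<open>a\<close>, both the first \<open>a + h\<close>
  vertices and those from \<open>a\<close> onwards form chains, and one of the two has at least \<open>(N + h) / 2\<close>
  elements.
\<close>

section \<open>Rooted forests\<close>

lemma rooted_forestD:
  assumes "rooted_forest V r"
  shows "finite V" and "r \<subseteq> V \<times> V" and "\<And>v. v \<in> V \<Longrightarrow> (v, v) \<in> r"
    and "antisym r" and "trans r"
    and "\<And>u v w. (u, w) \<in> r \<Longrightarrow> (v, w) \<in> r \<Longrightarrow> (u, v) \<in> r \<or> (v, u) \<in> r"
proof -
  have "finite V \<and> r \<subseteq> V \<times> V \<and> (\<forall>v\<in>V. (v, v) \<in> r) \<and> antisym r \<and> trans r"
    and chain: "\<forall>w\<in>V. \<forall>u v. (u, w) \<in> r \<longrightarrow> (v, w) \<in> r \<longrightarrow> (u, v) \<in> r \<or> (v, u) \<in> r"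
    using assms
    by (auto simp: rooted_forest_def partial_order_on_def preorder_on_def refl_on_def Chains_def)
  then show "finite V" and V: "r \<subseteq> V \<times> V" and "\<And>v. v \<in> V \<Longrightarrow> (v, v) \<in> r"
    and "antisym r" and "trans r"
    by auto
  show "(u, v) \<in> r \<or> (v, u) \<in> r" if "(u, w) \<in> r" "(v, w) \<in> r" for u v w
    using chain that V by blast
qed

lemma finite_card_Chains:
  assumes "rooted_forest V r"
  shows "finite (card ` Chains r)" and "card ` Chains r \<noteq> {}"
proof -
  have "Chains r \<subseteq> Pow V"
    using rooted_forestD(2)[OF assms] by (auto simp: Chains_def)
  then show "finite (card ` Chains r)"
    using rooted_forestD(1)[OF assms] by (meson finite_Pow_iff finite_imageI finite_subset)
  have "{} \<in> Chains r"
    by (simp add: Chains_def)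
  then show "card ` Chains r \<noteq> {}"
    by blast
qed

lemma card_chain_le_forest_height:
  assumes "rooted_forest V r" and "C \<in> Chains r"
  shows "card C \<le> forest_height r"
  unfolding forest_height_def using finite_card_Chains[OF assms(1)] assms(2) by auto

text \<open>Elements of a chain are pairwise comparable, so \<open>g\<close> is injective on every
  chain.\<close>

lemma forest_height_le:
  assumes "rooted_forest V r"
    and "\<And>u v. (u, v) \<in> r \<Longrightarrow> u \<noteq> v \<Longrightarrow> g u \<noteq> g v"
    and "\<And>v. v \<in> V \<Longrightarrow> g v \<in> S" and "finite S"
  shows "forest_height r \<le> card S"
proof -
  have "card C \<le> card S" if "C \<in> Chains r" for C
  proof -
    have "C \<subseteq> V"
      using that rooted_forestD(2)[OF assms(1)] by (auto simp: Chains_def)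
    moreover have "inj_on g C"
      using that assms(2) by (fastforce simp: inj_on_def Chains_def)
    ultimately show ?thesis
      using assms(3,4) by (meson card_inj_on_le image_subsetI subsetD)
  qed
  then show ?thesis
    unfolding forest_height_def using finite_card_Chains[OF assms(1)] by auto
qed

text \<open>Reflexivity on \<open>C\<close> is built into \<open>Chains\<close>, which compares each
  element with itself as well. The lemma will provide closest proper ancestors and the lowest vertex
  of a window.\<close>

lemma finite_chain_greatest:
  assumes "trans r" and "finite C" and "C \<in> Chains r" and "C \<noteq> {}"
  shows "\<exists>c\<in>C. \<forall>u\<in>C. (u, c) \<in> r"
  using assms(2,4,3)
proof (induction rule: finite_ne_induct)
  case (singleton x)
  then show ?case by (auto simp: Chains_def)
next
  case (insert x F)
  then obtain c where c: "c \<in> F" "\<forall>u\<in>F. (u, c) \<in> r"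
    by (auto simp: Chains_def)
  have x: "(x, x) \<in> r" "(x, c) \<in> r \<or> (c, x) \<in> r"
    using insert.prems c(1) by (auto simp: Chains_def)
  show ?case
  proof (cases "(x, c) \<in> r")
    case True
    then show ?thesis using c by auto
  next
    case False
    then have "(c, x) \<in> r" using x by simp
    then have "\<forall>u\<in>F. (u, x) \<in> r" using c(2) assms(1) by (meson transD)
    then show ?thesis using x by auto
  qed
qed

section \<open>Trees from parent functions\<close>

text \<open>Descending steps lead from every vertex to \<open>m\<close>. Connectedness is strong
  connectedness of the symmetric closure, where these walks can be reversed, so any two vertices are
  joined through \<open>m\<close>.\<close>

lemma connected_if_descending:
  fixes G :: "('b, 'c) pre_digraph" and rank :: "'b \<Rightarrow> nat"
  assumes "m \<in> verts G"
    and step: "\<And>x. x \<in> verts G \<Longrightarrow> x \<noteq> m \<Longrightarrow>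
      \<exists>y\<in>verts G. rank y < rank x \<and> (x, y) \<in> arcs_ends G"
  shows "connected G"
proof -
  let ?H = "with_proj (mk_symmetric G)"
  have sym: "(x, y) \<in> arcs_ends ?H \<and> (y, x) \<in> arcs_ends ?H" if "(x, y) \<in> arcs_ends G" for x y
    using that by (auto simp: parcs_mk_symmetric arcs_ends_conv)
  have V: "verts ?H = verts G" by simp
  have to_m: "x \<rightarrow>\<^sup>*\<^bsub>?H\<^esub> m \<and> m \<rightarrow>\<^sup>*\<^bsub>?H\<^esub> x" if "x \<in> verts G" for x
    using that
  proof (induction "rank x" arbitrary: x rule: less_induct)
    case less
    show ?case
    proof (cases "x = m")
      case True
      then show ?thesis
        using assms(1) by (auto simp: reachable_def)
    next
      case False
      then obtain y where y: "y \<in> verts G" "rank y < rank x" "(x, y) \<in> arcs_ends G"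
        using step less.prems by blast
      have IH: "y \<rightarrow>\<^sup>*\<^bsub>?H\<^esub> m" "m \<rightarrow>\<^sup>*\<^bsub>?H\<^esub> y"
        using less.hyps y by auto
      have "m \<rightarrow>\<^sup>*\<^bsub>?H\<^esub> x"
        using IH(2) sym[OF y(3)] less.prems unfolding reachable_def V
        by (blast intro: rtrancl_on_into_rtrancl_on)
      moreover have "x \<rightarrow>\<^sup>*\<^bsub>?H\<^esub> m"
        using IH(1) sym[OF y(3)] less.prems unfolding reachable_def V
        by (blast intro: converse_rtrancl_on_into_rtrancl_on)
      ultimately show ?thesis by simp
    qed
  qed
  show ?thesis
    unfolding connected_def
  proof (rule strongly_connectedI)
    show "verts ?H \<noteq> {}" using assms(1) by auto
    show "u \<rightarrow>\<^sup>*\<^bsub>?H\<^esub> v" if "u \<in> verts ?H" "v \<in> verts ?H" for u v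
      using to_m that unfolding reachable_def V by (blast intro: rtrancl_on_trans)
  qed
qed

text \<open>Indexed form of the recursive \<open>pcas\<close>; it lets a cycle be treated as a
  cyclic sequence of arcs.\<close>

lemma pcas_nth:
  assumes "pcas u c v"
  shows "c \<noteq> [] \<Longrightarrow> fst (c ! 0) = u" and "c \<noteq> [] \<Longrightarrow> snd (last c) = v"
    and "\<And>i. Suc i < length c \<Longrightarrow> fst (c ! Suc i) = snd (c ! i)"
  using assms
proof (induction c arbitrary: u)
  case (Cons e es)
  { case 1 then show ?case by simp }
  { case 2 then show ?case using Cons.IH(2)[of "snd e"] by (cases es) auto }
  { case (3 i)
    have es: "pcas (snd e) es v" using 3 by simp
    then show ?case
      using 3 Cons.IH(1)[OF _ es] Cons.IH(3)[OF _ es] by (cases i) auto }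
qed auto

lemma tl_pawalk_verts: "pcas u c v \<Longrightarrow> tl (pawalk_verts u c) = map snd c"
proof (induction c arbitrary: u)
  case (Cons e es)
  have "pawalk_verts (snd e) es = snd e # tl (pawalk_verts (snd e) es)" by (cases es) (use Cons in auto)
  then show ?case using Cons by auto
qed auto

text \<open>The decreasing rank forces iterated parents to end at the root. The value
  \<open>par root\<close> is arbitrary.\<close>

locale parent_function =
  fixes N :: "'b set" and root :: 'b and par :: "'b \<Rightarrow> 'b" and rank :: "'b \<Rightarrow> nat"
  assumes finite_nodes: "finite N" and root_in: "root \<in> N"
    and par_in: "\<And>x. x \<in> N \<Longrightarrow> x \<noteq> root \<Longrightarrow> par x \<in> N"
    and rank_par: "\<And>x. x \<in> N \<Longrightarrow> x \<noteq> root \<Longrightarrow> rank (par x) < rank x"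
begin

definition parent_graph :: "'b pair_pre_digraph" where
  "parent_graph = \<lparr> pverts = N, parcs = (\<Union>x\<in>N - {root}. {(x, par x), (par x, x)}) \<rparr>"

lemma pverts_parent_graph [simp]: "pverts parent_graph = N"
  by (simp add: parent_graph_def)

lemma parcs_parent_graph:
  "(x, y) \<in> parcs parent_graph \<longleftrightarrow>
     x \<in> N \<and> x \<noteq> root \<and> y = par x \<or> y \<in> N \<and> y \<noteq> root \<and> x = par y"
  by (auto simp: parent_graph_def)

lemma pair_graph_parent_graph: "pair_graph parent_graph"
proof
  show "finite (parcs parent_graph)"
    using finite_nodes by (simp add: parent_graph_def)
  show "symmetric (with_proj parent_graph)"
    unfolding symmetric_def by (rule symI) (auto simp: parcs_parent_graph)
  show "fst e \<noteq> snd e" if "e \<in> parcs parent_graph" for e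
    using that rank_par by (cases e) (fastforce simp: parcs_parent_graph)
qed (use finite_nodes par_in in \<open>auto simp: parcs_parent_graph\<close>)

text \<open>Parents lead up to \<open>m\<close> without leaving \<open>S\<close>. Later
  \<open>S\<close> is the set of nodes whose bags contain a given vertex.\<close>

lemma connected_induce_parent_graph:
  assumes "S \<subseteq> N" and "m \<in> S" and "\<And>x. x \<in> S \<Longrightarrow> x \<noteq> m \<Longrightarrow> x \<noteq> root \<and> par x \<in> S"
  shows "connected (induce_subgraph (with_proj parent_graph) S)"
proof (rule connected_if_descending)
  show "m \<in> verts (induce_subgraph (with_proj parent_graph) S)"
    using assms by simp
  fix x assume "x \<in> verts (induce_subgraph (with_proj parent_graph) S)" "x \<noteq> m"
  then have x: "x \<in> S" "x \<noteq> root" "par x \<in> S"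
    using assms(3) by auto
  have "(x, par x) \<in> arcs_ends (induce_subgraph (with_proj parent_graph) S)"
    using x assms(1) by (force simp: arcs_ends_conv parcs_parent_graph)
  then show "\<exists>y\<in>verts (induce_subgraph (with_proj parent_graph) S).
      rank y < rank x \<and> (x, y) \<in> arcs_ends (induce_subgraph (with_proj parent_graph) S)"
    using x assms(1) rank_par by auto
qed

text \<open>Both neighbours on a cycle of a cycle vertex of maximal rank would be its parent.\<close>

lemma undirected_tree_parent_graph: "undirected_tree parent_graph"
proof -
  have "connected (with_proj parent_graph)"
    by (rule connected_if_descending[of root _ rank])
      (use root_in par_in rank_par in \<open>auto simp: parcs_parent_graph\<close>)
  moreover have False if cycle: "pre_digraph.cycle (with_proj parent_graph) c" and len: "length c \<ge> 3" for c
  proof -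
    obtain u where c: "pcas u c u" "set c \<subseteq> parcs parent_graph" "distinct (tl (pawalk_verts u c))"
      using cycle by (auto simp: pre_digraph.cycle_def pre_digraph.awalk_def
          cas_with_proj_eq awalk_verts_with_proj_eq)
    let ?n = "length c"
    have "distinct (map snd c)"
      using c(3) by (simp add: tl_pawalk_verts[OF c(1)])
    then have dist: "snd (c ! i) \<noteq> snd (c ! j)" if "i < ?n" "j < ?n" "i \<noteq> j" for i j
      using that by (metis length_map nth_eq_iff_index_eq nth_map)
    have cne: "c \<noteq> []" using len by auto
    define prv where "prv i = (if i = 0 then ?n - 1 else i - 1)" for i
    define nxt where "nxt i = (if Suc i = ?n then 0 else Suc i)" for i
    have link: "fst (c ! i) = snd (c ! prv i)" if "i < ?n" for i
      using that pcas_nth[OF c(1)] cne by (cases i) (auto simp: prv_def last_conv_nth)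
    have link': "fst (c ! nxt i) = snd (c ! i)" if "i < ?n" for i
    proof -
      have "prv (nxt i) = i" "nxt i < ?n" using that by (auto simp: prv_def nxt_def)
      then show ?thesis using link[of "nxt i"] by simp
    qed
    define M where "M = Max ((\<lambda>i. rank (snd (c ! i))) ` {..<?n})"
    have "M \<in> (\<lambda>i. rank (snd (c ! i))) ` {..<?n}"
      unfolding M_def by (rule Max_in) (use cne in \<open>auto simp: lessThan_empty_iff\<close>)
    then obtain i where i: "i < ?n" "rank (snd (c ! i)) = M" by auto
    have le: "rank (snd (c ! j)) \<le> rank (snd (c ! i))" if "j < ?n" for j
      using that unfolding i(2) M_def by auto
    \<comment> \<open>On a closed walk of length 2 both indices would coincide; from length 3 on
      they differ.\<close>
    have ps: "prv i < ?n" "nxt i < ?n" "prv i \<noteq> nxt i"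
      using i len by (auto simp: prv_def nxt_def)
    have "(snd (c ! prv i), snd (c ! i)) \<in> parcs parent_graph"
      using link[OF i(1)] i(1) c(2) by (metis nth_mem prod.collapse subsetD)
    then have "snd (c ! prv i) = par (snd (c ! i))"
      using le[OF ps(1)] rank_par by (fastforce simp: parcs_parent_graph)
    moreover have "(snd (c ! i), snd (c ! nxt i)) \<in> parcs parent_graph"
      using link'[OF i(1)] ps(2) c(2) by (metis nth_mem prod.collapse subsetD)
    then have "snd (c ! nxt i) = par (snd (c ! i))"
      using le[OF ps(2)] rank_par by (fastforce simp: parcs_parent_graph)
    ultimately show False
      using dist[OF ps] by simp
  qed
  ultimately show ?thesis
    using pair_graph_parent_graph by (auto simp: undirected_tree_def)
qed

end

section \<open>Pebble forest covers bound treewidth and treedepth\<close>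

text \<open>In the pebble game played down the branch to \<open>v\<close>, these are the vertices
  that still carry their pebbles once \<open>v\<close> has been pebbled.\<close>

definition active :: "'a rel \<Rightarrow> ('a \<Rightarrow> nat) \<Rightarrow> 'a \<Rightarrow> 'a set" where
  "active r p v = {u. (u, v) \<in> r \<and> (\<forall>w. (u, w) \<in> r \<and> u \<noteq> w \<and> (w, v) \<in> r \<longrightarrow> p w \<noteq> p u)}"

text \<open>Active vertices are ancestors of \<open>v\<close>, hence pairwise comparable. If two of
  them had the same pebble, the lower one would have taken it from the upper one.\<close>

lemma card_active_le:
  assumes "rooted_forest V r" and "p ` V \<subseteq> {1..k}"
  shows "card (active r p v) \<le> k"
proof -
  note rf = rooted_forestD[OF assms(1)]
  have "inj_on p (active r p v)"
  proof (rule inj_onI)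
    fix x y assume xy: "x \<in> active r p v" "y \<in> active r p v" "p x = p y"
    then have "(x, v) \<in> r" "(y, v) \<in> r" by (auto simp: active_def)
    then have "(x, y) \<in> r \<or> (y, x) \<in> r" by (rule rf(6))
    then show "x = y" using xy by (auto simp: active_def)
  qed
  moreover have "p ` active r p v \<subseteq> {1..k}"
    using assms(2) rf(2) by (auto simp: active_def)
  ultimately have "card (active r p v) \<le> card {1..k}"
    by (meson card_inj_on_le finite_atLeastAtMost)
  then show ?thesis by simp
qed

text \<open>An edge lies in the bag of its lower end. The nodes whose bags contain \<open>v\<close>
  form a subtree with top \<open>v\<close>, because a vertex that is active at a proper descendant
  \<open>y\<close> is also active at the parent of \<open>y\<close>.\<close>

lemma treewidth_le_of_pebble_forest_cover:
  fixes G :: "'a pair_pre_digraph"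
  assumes pfc: "pebble_forest_cover k G r p" and "pair_graph G"
  shows "treewidth G \<le> k - 1"
proof -
  define V where "V = pverts G"
  have fc: "forest_cover G r" and pk: "p ` V \<subseteq> {1..k}"
    and peb: "\<And>u v w. (u, v) \<in> parcs G \<Longrightarrow> (u, v) \<in> r \<Longrightarrow> (u, w) \<in> r \<Longrightarrow> u \<noteq> w \<Longrightarrow> (w, v) \<in> r
        \<Longrightarrow> p w \<noteq> p u"
    using pfc unfolding pebble_forest_cover_def V_def by blast+
  have rfor: "rooted_forest V r"
    using fc by (simp add: forest_cover_def V_def)
  note rf = rooted_forestD[OF rfor]
  obtain g :: "'a \<Rightarrow> nat" where g: "inj_on g V"
    using finite_imp_inj_to_nat_seg[OF rf(1)] by blast
  \<comment> \<open>Nodes are natural numbers, as in \<open>treewidth\<close>; the successor keeps 0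
    free for the additional root, which joins the components of the forest.\<close>
  define node where "node v = Suc (g v)" for v
  have node: "inj_on node V" "\<And>v. node v \<noteq> 0"
    using g by (auto simp: node_def inj_on_def)
  define vert where "vert x = the_inv_into V node x" for x
  have vert: "vert (node v) = v" if "v \<in> V" for v
    unfolding vert_def using node(1) that by (rule the_inv_into_f_f)
  define above where "above v = {u. (u, v) \<in> r \<and> u \<noteq> v}" for v
  have above_sub: "above v \<subseteq> V" for v
    using rf(2) by (auto simp: above_def)
  \<comment> \<open>The closest proper ancestor; it exists because the proper ancestors form a
    finite chain.\<close>
  define up where "up v = (SOME c. c \<in> above v \<and> (\<forall>u\<in>above v. (u, c) \<in> r))" for v
  have up: "up v \<in> above v \<and> (\<forall>u\<in>above v. (u, up v) \<in> r)" if "above v \<noteq> {}" for v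
  proof -
    have "above v \<in> Chains r"
      using rf(6) by (auto simp: Chains_def above_def)
    then have "\<exists>c. c \<in> above v \<and> (\<forall>u\<in>above v. (u, c) \<in> r)"
      using finite_chain_greatest[OF rf(5)] that finite_subset[OF above_sub rf(1)] by blast
    then show ?thesis unfolding up_def by (rule someI_ex)
  qed
  have card_above: "card (above u) < card (above v)" if "u \<in> above v" for u v
  proof (rule psubset_card_mono)
    show "finite (above v)" using finite_subset[OF above_sub rf(1)] .
    have "above u \<subseteq> above v"
    proof
      fix w assume "w \<in> above u"
      then have w: "(w, u) \<in> r" "w \<noteq> u" by (auto simp: above_def)
      have u: "(u, v) \<in> r" using that by (simp add: above_def)
      have "w \<noteq> v" using w u antisymD[OF rf(4)] by blast
      then show "w \<in> above v" using transD[OF rf(5) w(1) u] by (simp add: above_def)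
    qed
    moreover have "u \<notin> above u" by (simp add: above_def)
    ultimately show "above u \<subset> above v" using that by auto
  qed
  define N where "N = insert 0 (node ` V)"
  define par where "par x = (if above (vert x) = {} then 0 else node (up (vert x)))" for x
  \<comment> \<open>The level in the extended tree: roots of the forest get 1, one more than the
    additional root.\<close>
  define rank where "rank x = (if x = 0 then 0 else Suc (card (above (vert x))))" for x
  interpret parent_function N 0 par rank
  proof
    show "finite N" using rf(1) by (simp add: N_def)
    show "0 \<in> N" by (simp add: N_def)
    fix x assume "x \<in> N" "x \<noteq> 0"
    then obtain v where v: "v \<in> V" "x = node v" by (auto simp: N_def)
    have upV: "up v \<in> V" if "above v \<noteq> {}" using up[OF that] above_sub by blast
    then show "par x \<in> N"
      using v by (simp add: par_def N_def vert)
    show "rank (par x) < rank x"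
      using v up[of v] card_above[of "up v" v] upV
      by (simp add: rank_def par_def node(2) vert)
  qed
  \<comment> \<open>The empty bag keeps 0 out of all the node sets that have to be
    connected.\<close>
  define B where "B x = (if x = 0 then {} else active r p (vert x))" for x
  have node_in: "node v \<in> N" if "v \<in> V" for v
    using that by (simp add: N_def)
  have self_active: "v \<in> active r p v" if "v \<in> V" for v
  proof -
    have "w = v" if "(v, w) \<in> r" "(w, v) \<in> r" for w
      using antisymD[OF rf(4) that] by simp
    then show ?thesis using rf(3)[OF that] unfolding active_def by blast
  qed
  have "tree_decomposition G parent_graph B"
    unfolding tree_decomposition_def
  proof (intro conjI ballI undirected_tree_parent_graph)
    fix t assume "t \<in> pverts parent_graph"
    show "B t \<subseteq> pverts G" using rf(2) by (auto simp: B_def active_def V_def)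
  next
    fix e assume e: "e \<in> parcs G"
    have *: "\<exists>t\<in>pverts parent_graph. u \<in> B t \<and> v \<in> B t"
      if uv: "(u, v) \<in> parcs G" "(u, v) \<in> r" for u v
    proof (intro bexI conjI)
      have v: "v \<in> V" using uv(2) rf(2) by blast
      then show "node v \<in> pverts parent_graph" using node_in by simp
      show "u \<in> B (node v)"
        using v uv(2) peb[OF uv] by (simp add: B_def node(2) active_def vert)
      show "v \<in> B (node v)"
        using v self_active by (simp add: B_def node(2) vert)
    qed
    obtain u v where uv: "e = (u, v)" by force
    interpret G: pair_graph G by fact
    have "(v, u) \<in> parcs G"
      using e uv G.pair_sym_arcs by (auto simp: symmetric_def dest: symD)
    moreover have "(u, v) \<in> r \<or> (v, u) \<in> r"
      using fc e uv by (auto simp: forest_cover_def)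
    ultimately show "case e of (u, v) \<Rightarrow> \<exists>t\<in>pverts parent_graph. u \<in> B t \<and> v \<in> B t"
      using * e uv by auto
  next
    fix v assume "v \<in> pverts G"
    then have v: "v \<in> V" by (simp add: V_def)
    show "connected (induce_subgraph (with_proj parent_graph) {t \<in> pverts parent_graph. v \<in> B t})"
    proof (rule connected_induce_parent_graph)
      show "node v \<in> {t \<in> pverts parent_graph. v \<in> B t}"
        using v self_active node_in by (simp add: B_def node(2) vert)
      fix x assume x: "x \<in> {t \<in> pverts parent_graph. v \<in> B t}" "x \<noteq> node v"
      then have "x \<noteq> 0" by (auto simp: B_def split: if_splits)
      moreover have "x \<in> N" using x by simp
      ultimately obtain y where y: "y \<in> V" "x = node y" by (auto simp: N_def)
      have act: "v \<in> active r p y" using x y by (simp add: B_def node(2) vert)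
      then have "v \<in> above y" using x y by (auto simp: active_def above_def)
      then have ne: "above y \<noteq> {}" and vup: "(v, up y) \<in> r" using up[of y] by auto
      have upV: "up y \<in> V" and upy: "(up y, y) \<in> r"
        using up[OF ne] above_sub by (auto simp: above_def)
      \<comment> \<open>Since \<open>up y\<close> is an ancestor of \<open>y\<close>, every vertex
        between \<open>v\<close> and \<open>up y\<close> is also between \<open>v\<close> and
        \<open>y\<close>.\<close>
      have "v \<in> active r p (up y)"
        unfolding active_def using act vup transD[OF rf(5) _ upy] by (simp add: active_def)
      then show "x \<noteq> 0 \<and> par x \<in> {t \<in> pverts parent_graph. v \<in> B t}"
        using y ne upV by (simp add: par_def B_def node(2) node_in vert)
    qed auto
  qed
  moreover have "decomposition_width parent_graph B \<le> k - 1"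
  proof -
    have "card (B t) \<le> k" for t
      using card_active_le[OF rfor pk] by (simp add: B_def)
    then have "Max ((\<lambda>t. card (B t)) ` pverts parent_graph) \<le> k"
      using finite_nodes root_in by (subst Max_le_iff) auto
    then show ?thesis by (simp add: decomposition_width_def)
  qed
  moreover have "treewidth G \<le> decomposition_width parent_graph B"
    unfolding treewidth_def by (rule Least_le) (use calculation(1) in blast)
  ultimately show ?thesis by simp
qed

lemma treedepth_le: "forest_cover G r \<Longrightarrow> treedepth G \<le> forest_height r"
  unfolding treedepth_def by (rule Least_le) blast

lemma PFC_subset: "PFC k q \<subseteq> TW (k - 1) \<inter> TD q"
proof
  fix G assume "G \<in> PFC k q"
  then obtain r p where G: "pair_graph G" "pebble_forest_cover k G r p" "forest_height r \<le> q"
    by (auto simp: PFC_def)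
  then have "treedepth G \<le> q"
    using treedepth_le[of G r] by (simp add: pebble_forest_cover_def)
  then show "G \<in> TW (k - 1) \<inter> TD q"
    using G treewidth_le_of_pebble_forest_cover by (simp add: TW_def TD_def)
qed

section \<open>Powers of paths\<close>

text \<open>Adjacency is index distance between 1 and \<open>h\<close>; adding \<open>h\<close> on
  either side avoids truncated subtraction. The function \<open>f\<close> carries the indices into
  the vertex type.\<close>

definition path_power :: "(nat \<Rightarrow> 'a) \<Rightarrow> nat \<Rightarrow> nat \<Rightarrow> 'a pair_pre_digraph" where
  "path_power f h N = \<lparr> pverts = f ` {..<N},
     parcs = {(f i, f j) |i j. i < N \<and> j < N \<and> i \<noteq> j \<and> i \<le> j + h \<and> j \<le> i + h} \<rparr>"

definition image_rel :: "(nat \<Rightarrow> 'a) \<Rightarrow> nat \<Rightarrow> (nat \<Rightarrow> nat \<Rightarrow> bool) \<Rightarrow> 'a rel" where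
  "image_rel f N R = {(f i, f j) |i j. i < N \<and> j < N \<and> R i j}"

context
  fixes f :: "nat \<Rightarrow> 'a" and h N :: nat
  assumes inj: "inj f"
begin

lemma pverts_path_power [simp]: "pverts (path_power f h N) = f ` {..<N}"
  by (simp add: path_power_def)

lemma parcs_path_power [simp]:
  "(f i, f j) \<in> parcs (path_power f h N) \<longleftrightarrow> i < N \<and> j < N \<and> i \<noteq> j \<and> i \<le> j + h \<and> j \<le> i + h"
  using inj by (auto simp: path_power_def inj_eq)

lemma parcs_path_powerE:
  assumes "(u, v) \<in> parcs (path_power f h N)"
  obtains i j where "u = f i" "v = f j" "i < N" "j < N" "i \<noteq> j" "i \<le> j + h" "j \<le> i + h"
  using assms by (auto simp: path_power_def)

lemma image_rel_iff [simp]: "(f i, f j) \<in> image_rel f N R \<longleftrightarrow> i < N \<and> j < N \<and> R i j"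
  using inj by (auto simp: image_rel_def inj_eq)

lemma image_relE:
  assumes "(u, v) \<in> image_rel f N R"
  obtains i j where "u = f i" "v = f j" "i < N" "j < N" "R i j"
  using assms by (auto simp: image_rel_def)

lemma pair_graph_path_power: "pair_graph (path_power f h N)"
proof
  have "parcs (path_power f h N) \<subseteq> f ` {..<N} \<times> f ` {..<N}"
    by (auto simp: path_power_def)
  then show "finite (parcs (path_power f h N))"
    by (rule finite_subset) simp
  show "symmetric (with_proj (path_power f h N))"
    unfolding symmetric_def by (rule symI) (auto elim!: parcs_path_powerE)
qed (use inj in \<open>auto simp: path_power_def inj_eq\<close>)

lemma forest_cover_image_rel:
  assumes "\<And>i. i < N \<Longrightarrow> R i i" and "\<And>i j. R i j \<Longrightarrow> R j i \<Longrightarrow> i = j"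
    and "\<And>i j l. i < N \<Longrightarrow> j < N \<Longrightarrow> l < N \<Longrightarrow> R i j \<Longrightarrow> R j l \<Longrightarrow> R i l"
    and "\<And>i j l. i < N \<Longrightarrow> j < N \<Longrightarrow> l < N \<Longrightarrow> R i l \<Longrightarrow> R j l \<Longrightarrow> R i j \<or> R j i"
    and "\<And>i j. i < j \<Longrightarrow> j < N \<Longrightarrow> j \<le> i + h \<Longrightarrow> R i j \<or> R j i"
  shows "forest_cover (path_power f h N) (image_rel f N R)"
proof -
  have "trans (image_rel f N R)"
  proof (rule transI)
    fix u v w assume "(u, v) \<in> image_rel f N R" "(v, w) \<in> image_rel f N R"
    then obtain i j l where "u = f i" "v = f j" "w = f l" "i < N" "j < N" "l < N" "R i j" "R j l"
      by (metis image_relE image_rel_iff)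
    then show "(u, w) \<in> image_rel f N R" using assms(3)[of i j l] by simp
  qed
  moreover have "antisym (image_rel f N R)"
  proof (rule antisymI)
    fix u v assume "(u, v) \<in> image_rel f N R" "(v, u) \<in> image_rel f N R"
    then obtain i j where "u = f i" "v = f j" "R i j" "R j i"
      by (metis image_relE image_rel_iff)
    then show "u = v" using assms(2)[of i j] by simp
  qed
  moreover have "{u. (u, v) \<in> image_rel f N R} \<in> Chains (image_rel f N R)" for v
    unfolding Chains_def
  proof (intro CollectI ballI, elim CollectE)
    fix u w assume "(u, v) \<in> image_rel f N R" "(w, v) \<in> image_rel f N R"
    then obtain i j l where "u = f i" "w = f j" "v = f l" "i < N" "j < N" "l < N" "R i l" "R j l"
      by (metis image_relE image_rel_iff)
    then show "(u, w) \<in> image_rel f N R \<or> (w, u) \<in> image_rel f N R"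
      using assms(4)[of i j l] by simp
  qed
  moreover have "(u, v) \<in> image_rel f N R \<or> (v, u) \<in> image_rel f N R"
    if "(u, v) \<in> parcs (path_power f h N)" for u v
    using that
  proof (rule parcs_path_powerE)
    fix i j assume "u = f i" "v = f j" "i < N" "j < N" "i \<noteq> j" "i \<le> j + h" "j \<le> i + h"
    then show ?thesis
      using assms(5)[of i j] assms(5)[of j i] by (cases i j rule: linorder_cases) auto
  qed
  moreover have "image_rel f N R \<subseteq> f ` {..<N} \<times> f ` {..<N}"
    by (auto simp: image_rel_def)
  moreover have "\<forall>x\<in>f ` {..<N}. (x, x) \<in> image_rel f N R"
    using assms(1) by simp
  ultimately show ?thesis
    unfolding forest_cover_def rooted_forest_def partial_order_on_def preorder_on_def refl_on_def
    by auto
qed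

text \<open>Order the vertices along the path and reuse the pebbles cyclically: an edge spans at
  most \<open>h\<close> indices, so residues modulo \<open>h + 1\<close> do not repeat along it. The
  cover serves to bound the treewidth by \<open>h\<close>, and its depth is left open.\<close>

lemma path_power_pebble_forest_cover:
  "\<exists>r p. pebble_forest_cover (Suc h) (path_power f h N) r p"
proof (intro exI)
  let ?r = "image_rel f N (\<le>)" and ?p = "\<lambda>v. Suc (inv f v mod Suc h)"
  have "forest_cover (path_power f h N) ?r"
    by (rule forest_cover_image_rel) auto
  moreover have "?p ` pverts (path_power f h N) \<subseteq> {1..Suc h}"
    by (auto simp: less_eq_Suc_le[symmetric])
  moreover have "?p w \<noteq> ?p u"
    if uv: "(u, v) \<in> parcs (path_power f h N)" "(u, w) \<in> ?r" "u \<noteq> w" "(w, v) \<in> ?r" for u v w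
  proof -
    obtain i l j where ilj: "u = f i" "w = f l" "v = f j" "i \<le> l" "l \<le> j"
      using uv(2,4) inj by (auto elim!: image_relE simp: inj_eq)
    then have "i \<noteq> l" using uv(3) by auto
    then have "i < l" "l \<le> i + h" using ilj uv(1) by auto
    then have "l mod Suc h \<noteq> i mod Suc h"
      using mod_eq_dvd_iff_nat[of i l "Suc h"] by (auto dest!: dvd_imp_le)
    then show ?thesis using ilj inj by (simp add: inv_f_f)
  qed
  ultimately show "pebble_forest_cover (Suc h) (path_power f h N) ?r ?p"
    unfolding pebble_forest_cover_def by blast
qed

end

subsection \<open>Treedepth\<close>

text \<open>A vertex ranking of the path on \<open>n\<close> vertices, with small ranks meant to be
  near the root.\<close>

definition separated_ranking :: "nat \<Rightarrow> (nat \<Rightarrow> nat) \<Rightarrow> bool" where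
  "separated_ranking n \<rho> \<longleftrightarrow>
     (\<forall>a b. a < b \<and> b < n \<and> \<rho> a = \<rho> b \<longrightarrow> (\<exists>t. a < t \<and> t < b \<and> \<rho> t < \<rho> a))"

text \<open>The ranks are the levels of the complete binary search tree: even positions form a new
  lowest level, and odd positions copy the previous ranking.\<close>

lemma separated_ranking_exists:
  "\<exists>\<rho>. separated_ranking (2 ^ m - 1) \<rho> \<and> (\<forall>a < 2 ^ m - 1. \<rho> a < m)"
proof (induction m)
  case 0
  then show ?case by (simp add: separated_ranking_def)
next
  case (Suc m)
  then obtain \<rho> where sep: "separated_ranking (2 ^ m - 1) \<rho>" and less: "\<And>a. a < 2 ^ m - 1 \<Longrightarrow> \<rho> a < m"
    by blast
  define \<rho>' where "\<rho>' a = (if even a then m else \<rho> (a div 2))" for a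
  have half: "a div 2 < 2 ^ m - 1" if "a < 2 ^ Suc m - 1" "odd a" for a :: nat
    using that by (auto elim!: oddE)
  have "separated_ranking (2 ^ Suc m - 1) \<rho>'"
    unfolding separated_ranking_def
  proof (intro allI impI, elim conjE)
    fix a b assume ab: "a < b" "b < 2 ^ Suc m - 1" "\<rho>' a = \<rho>' b"
    show "\<exists>t. a < t \<and> t < b \<and> \<rho>' t < \<rho>' a"
    proof (cases "even a")
      case True
      then have "even b"
        using ab(3) half[OF ab(2)] less[of "b div 2"] by (auto simp: \<rho>'_def split: if_splits)
      \<comment> \<open>Two even positions enclose the odd position \<open>Suc a\<close>, whose rank
        is below \<open>m\<close>.\<close>
      then have "Suc a < b" using True ab(1) by (metis Suc_lessI even_Suc)
      moreover have "\<rho>' (Suc a) < m"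
        using half[of "Suc a"] less True \<open>Suc a < b\<close> ab(2) by (auto simp: \<rho>'_def)
      ultimately show ?thesis using True by (auto simp: \<rho>'_def intro!: exI[of _ "Suc a"])
    next
      case False
      then have "odd b"
        using ab half[of a] less[of "a div 2"] by (auto simp: \<rho>'_def split: if_splits)
      have "a div 2 < b div 2"
        using ab(1) False \<open>odd b\<close> by (auto elim!: oddE)
      then obtain t where "a div 2 < t" "t < b div 2" "\<rho> t < \<rho> (a div 2)"
        using sep half[OF ab(2) \<open>odd b\<close>] ab(3) False \<open>odd b\<close>
        by (auto simp: separated_ranking_def \<rho>'_def)
      then show ?thesis
        using False \<open>odd b\<close> by (intro exI[of _ "Suc (2 * t)"]) (auto simp: \<rho>'_def elim!: oddE)
    qed
  qed
  moreover have "\<rho>' a < Suc m" if "a < 2 ^ Suc m - 1" for a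
    using that half less by (auto simp: \<rho>'_def less_Suc_eq)
  ultimately show ?case by blast
qed

text \<open>The ancestor relation of the Cartesian tree of \<open>\<rho>\<close>.\<close>

definition cartesian :: "(nat \<Rightarrow> nat) \<Rightarrow> nat \<Rightarrow> nat \<Rightarrow> bool" where
  "cartesian \<rho> a b \<longleftrightarrow> (\<forall>t. a < t \<and> t \<le> b \<or> b \<le> t \<and> t < a \<longrightarrow> \<rho> a < \<rho> t)"

lemma cartesian_refl: "cartesian \<rho> a a"
  by (simp add: cartesian_def)

lemma cartesian_less: "cartesian \<rho> a b \<Longrightarrow> a \<noteq> b \<Longrightarrow> \<rho> a < \<rho> b"
  unfolding cartesian_def by (metis linorder_neqE_nat order_refl)

text \<open>Every \<open>t\<close> to be checked lies in the range from \<open>a\<close> to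
  \<open>b\<close>, or in the range from \<open>b\<close> to \<open>c\<close>, where its rank
  exceeds that of \<open>b\<close> and hence that of \<open>a\<close>.\<close>

lemma cartesian_trans:
  assumes "cartesian \<rho> a b" and "cartesian \<rho> b c"
  shows "cartesian \<rho> a c"
proof (cases "a = b")
  case False
  then have ab: "\<rho> a < \<rho> b" by (rule cartesian_less[OF assms(1)])
  show ?thesis
    unfolding cartesian_def
  proof (intro allI impI)
    fix t assume t: "a < t \<and> t \<le> c \<or> c \<le> t \<and> t < a"
    then consider "a < t \<and> t \<le> b \<or> b \<le> t \<and> t < a" | "b < t \<and> t \<le> c \<or> c \<le> t \<and> t < b"
      by linarith
    then show "\<rho> a < \<rho> t"
      using assms ab unfolding cartesian_def by cases (auto intro: less_trans)
  qed
qed (use assms in simp)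

text \<open>If \<open>a\<close> and \<open>b\<close> are on the same side of \<open>c\<close>, the
  farther one is the ancestor, since its range to \<open>c\<close> covers the nearer one. If they
  enclose \<open>c\<close>, every position between them has a rank above that of \<open>a\<close> or
  of \<open>b\<close>; separation excludes equal ranks, and then the smaller rank wins.\<close>

lemma cartesian_below:
  assumes "separated_ranking n \<rho>" and "a < n" and "b < n"
    and "cartesian \<rho> a c" and "cartesian \<rho> b c"
  shows "cartesian \<rho> a b \<or> cartesian \<rho> b a"
  using assms(2-)
proof (induction a b rule: linorder_wlog)
  case (le a b)
  show ?case
  proof (cases "a = b \<or> b \<le> c \<or> c \<le> a")
    case True
    then show ?thesis
      using le unfolding cartesian_def by (metis le_neq_implies_less le_trans less_le_trans nle_le order_le_less_trans)
  next
    case False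
    then have ac: "\<And>t. a < t \<Longrightarrow> t \<le> c \<Longrightarrow> \<rho> a < \<rho> t" and bc: "\<And>t. c \<le> t \<Longrightarrow> t < b \<Longrightarrow> \<rho> b < \<rho> t"
      using le by (auto simp: cartesian_def)
    have between: "\<rho> a < \<rho> t \<or> \<rho> b < \<rho> t" if "a < t" "t < b" for t
      using ac bc that by (meson nle_le)
    have "\<rho> a \<noteq> \<rho> b"
      using assms(1) le False between unfolding separated_ranking_def
      by (metis le_neq_implies_less not_less_iff_gr_or_eq)
    then consider "\<rho> a < \<rho> b" | "\<rho> b < \<rho> a" by linarith
    then show ?thesis
    proof cases
      case 1
      then have "cartesian \<rho> a b"
        using between le(1) unfolding cartesian_def by (metis le_neq_implies_less less_trans linorder_not_less)
      then show ?thesis ..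
    next
      case 2
      then have "cartesian \<rho> b a"
        using between le(1) unfolding cartesian_def by (metis le_neq_implies_less less_trans linorder_not_less)
      then show ?thesis ..
    qed
  qed
next
  case (sym a b)
  then show ?case by blast
qed

text \<open>Nothing lies between neighbours, so separation forces distinct ranks. This will cover
  the edges between consecutive blocks.\<close>

lemma cartesian_Suc:
  assumes "separated_ranking n \<rho>" and "Suc a < n"
  shows "cartesian \<rho> a (Suc a) \<or> cartesian \<rho> (Suc a) a"
proof -
  have "\<rho> a \<noteq> \<rho> (Suc a)"
    using assms unfolding separated_ranking_def by (metis lessI not_less_eq)
  moreover have "cartesian \<rho> a (Suc a)" if "\<rho> a < \<rho> (Suc a)"
    using that by (auto simp: cartesian_def le_Suc_eq)
  moreover have "cartesian \<rho> (Suc a) a" if "\<rho> (Suc a) < \<rho> a"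
    using that by (auto simp: cartesian_def less_Suc_eq)
  ultimately show ?thesis by linarith
qed

text \<open>The forest is the Cartesian tree on the blocks with each block unfolded into a chain of
  its \<open>h\<close> vertices.\<close>

lemma treedepth_path_power_le:
  assumes "inj f" and "0 < h"
  shows "treedepth (path_power f h (h * (2 ^ m - 1))) \<le> h * m"
proof -
  let ?N = "h * (2 ^ m - 1)"
  obtain \<rho> where sep: "separated_ranking (2 ^ m - 1) \<rho>" and less: "\<And>a. a < 2 ^ m - 1 \<Longrightarrow> \<rho> a < m"
    using separated_ranking_exists by blast
  define b where "b i = i div h" for i
  have blk: "b i < 2 ^ m - 1" if "i < ?N" for i
    using that by (simp add: b_def less_mult_imp_div_less mult.commute)
  define R where "R i j \<longleftrightarrow> (if b i = b j then i \<le> j else cartesian \<rho> (b i) (b j))" for i j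
  have cov: "forest_cover (path_power f h ?N) (image_rel f ?N R)"
  proof (rule forest_cover_image_rel[OF assms(1)])
    show "R i i" for i by (simp add: R_def)
    show "i = j" if "R i j" "R j i" for i j
    proof (cases "b i = b j")
      case True
      then show ?thesis using that by (simp add: R_def)
    next
      case False
      then have "\<rho> (b i) < \<rho> (b j)" "\<rho> (b j) < \<rho> (b i)"
        using that cartesian_less by (auto simp: R_def)
      then show ?thesis by simp
    qed
    show "R i l" if "R i j" "R j l" for i j l
    proof (cases "b i = b j \<or> b j = b l")
      case True
      then show ?thesis using that by (auto simp: R_def)
    next
      case False
      then have c: "cartesian \<rho> (b i) (b j)" "cartesian \<rho> (b j) (b l)"
        using that by (simp_all add: R_def)
      then have "\<rho> (b i) < \<rho> (b l)"
        using False cartesian_less by (meson less_trans)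
      then show ?thesis using cartesian_trans[OF c] by (auto simp: R_def)
    qed
    show "R i j \<or> R j i" if "i < ?N" "j < ?N" "l < ?N" "R i l" "R j l" for i j l
    proof (cases "b i = b j")
      case True
      then show ?thesis by (auto simp: R_def)
    next
      case False
      have "cartesian \<rho> (b i) (b l)" "cartesian \<rho> (b j) (b l)"
        using that(4,5) by (auto simp: R_def cartesian_refl split: if_splits)
      then show ?thesis
        using cartesian_below[OF sep blk[OF that(1)] blk[OF that(2)]] False by (simp add: R_def)
    qed
    show "R i j \<or> R j i" if ij: "i < j" "j < ?N" "j \<le> i + h" for i j
    proof (cases "b i = b j")
      case True
      then show ?thesis using ij by (simp add: R_def)
    next
      case False
      \<comment> \<open>An edge spans at most \<open>h\<close> indices, so it reaches no further
        than the next block.\<close>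
      have "b i \<le> b j" "b j \<le> (i + h) div h"
        unfolding b_def using ij by (intro div_le_mono; simp)+
      then have "b j = Suc (b i)"
        using False assms(2) by (simp add: b_def)
      then show ?thesis
        using cartesian_Suc[OF sep, of "b i"] blk[OF ij(2)] by (simp add: R_def)
    qed
  qed
  \<comment> \<open>Comparable vertices in different blocks differ in the rank of the block, those
    in the same block in the position within it.\<close>
  define g where "g v = (\<rho> (b (inv f v)), inv f v mod h)" for v
  have "forest_height (image_rel f ?N R) \<le> card ({..<m} \<times> {..<h})"
  proof (rule forest_height_le)
    show "rooted_forest (f ` {..<?N}) (image_rel f ?N R)"
      using cov assms(1) by (simp add: forest_cover_def pverts_path_power)
    show "g u \<noteq> g v" if uv: "(u, v) \<in> image_rel f ?N R" "u \<noteq> v" for u v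
    proof -
      obtain i j where ij: "u = f i" "v = f j" "R i j" "i \<noteq> j"
        using uv by (auto simp: image_rel_def)
      have "i mod h \<noteq> j mod h" if "b i = b j"
        using that ij(4) unfolding b_def by (metis div_mult_mod_eq)
      then show ?thesis
        using ij(3) cartesian_less[of \<rho> "b i" "b j"] assms(1) unfolding ij(1,2)
        by (auto simp: g_def inv_f_f R_def split: if_splits)
    qed
    show "g v \<in> {..<m} \<times> {..<h}" if "v \<in> f ` {..<?N}" for v
      using that assms less[OF blk] by (auto simp: g_def inv_f_f)
  qed auto
  then show ?thesis
    using treedepth_le[OF cov] by (simp add: mult.commute)
qed

subsection \<open>Depth of pebble forest covers\<close>

text \<open>
  \<open>R\<close> is the ancestor relation; \<open>h_pos\<close> makes consecutive windows \<open>{i..i + h}\<close> overlap.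
\<close>

locale path_power_cover =
  fixes h N :: nat and R :: "nat \<Rightarrow> nat \<Rightarrow> bool" and p :: "nat \<Rightarrow> nat"
  assumes h_pos: "0 < h"
    and R_refl: "\<And>i. i < N \<Longrightarrow> R i i"
    and R_antisym: "\<And>i j. R i j \<Longrightarrow> R j i \<Longrightarrow> i = j"
    and R_trans: "\<And>i j l. R i j \<Longrightarrow> R j l \<Longrightarrow> R i l"
    and R_below: "\<And>i j l. R i l \<Longrightarrow> R j l \<Longrightarrow> R i j \<or> R j i"
    and R_edge: "\<And>i j. i < N \<Longrightarrow> j < N \<Longrightarrow> i \<le> j + h \<Longrightarrow> j \<le> i + h \<Longrightarrow> R i j \<or> R j i"
    and p_range: "\<And>i. i < N \<Longrightarrow> p i \<in> {1..Suc h}"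
    and pebble: "\<And>i j w. i < N \<Longrightarrow> j < N \<Longrightarrow> i \<noteq> j \<Longrightarrow> i \<le> j + h \<Longrightarrow> j \<le> i + h \<Longrightarrow>
      R i j \<Longrightarrow> R i w \<Longrightarrow> i \<noteq> w \<Longrightarrow> R w j \<Longrightarrow> p w \<noteq> p i"
begin

text \<open>A window inside the path is a clique, hence a chain; the condition says that its lowest
  vertex is its leftmost one.\<close>

definition leftmost_last :: "nat \<Rightarrow> bool" where
  "leftmost_last i \<longleftrightarrow> (\<forall>j\<in>{i..i + h}. R j i)"

text \<open>The lower end of an edge is itself among the vertices that must not reuse the pebble of
  the upper end.\<close>

lemma p_edge:
  assumes "i < N" "j < N" "i \<noteq> j" "i \<le> j + h" "j \<le> i + h"
  shows "p i \<noteq> p j"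
  using R_edge[of i j] pebble[of i j j] pebble[of j i i] R_refl[of i] R_refl[of j] assms by metis

lemma p_window:
  assumes "i + h < N"
  shows "p ` {i..i + h} = {1..Suc h}"
proof (rule card_subset_eq)
  show "p ` {i..i + h} \<subseteq> {1..Suc h}"
    using p_range assms by fastforce
  have "inj_on p {i..i + h}"
    by (rule inj_onI, rule ccontr) (use p_edge assms in force)
  then show "card (p ` {i..i + h}) = card {1..Suc h}"
    by (simp add: card_image)
qed simp

text \<open>It suffices to place the new vertex below the lowest vertex \<open>c\<close> of the
  window. Otherwise it would be above \<open>c\<close>, and two vertices with the same pebble would
  interfere on an edge ending in \<open>c\<close>.\<close>

lemma not_leftmost_last_next:
  assumes N: "i + h + 1 < N" and "\<not> leftmost_last i"
  shows "\<forall>j\<in>{i..i + h}. R j (i + h + 1)"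
proof -
  let ?b = "i + h + 1"
  obtain c where c: "c \<in> {i..i + h}" "\<forall>j\<in>{i..i + h}. R j c"
  proof -
    have "trans {(i, j). R i j}" using R_trans by (auto intro: transI)
    moreover have "{i..i + h} \<in> Chains {(i, j). R i j}" using R_edge N by (simp add: Chains_def)
    ultimately show thesis using finite_chain_greatest[of _ "{i..i + h}"] that by fastforce
  qed
  have ci: "c \<noteq> i" using c assms(2) by (auto simp: leftmost_last_def)
  \<comment> \<open>The window at \<open>i + 1\<close> also uses all pebbles, and \<open>p i\<close>
    cannot recur on the neighbours of \<open>i\<close>.\<close>
  have pib: "p i = p ?b"
  proof -
    have "p i \<in> p ` {i + 1..i + 1 + h}"
      using p_window[of "i + 1"] p_range[of i] N by simp
    then obtain j where j: "j \<in> {i + 1..i + 1 + h}" "p i = p j" by blast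
    have "\<not> j \<le> i + h" using p_edge[of i j] j N by auto
    then show ?thesis using j by (simp add: le_antisym not_less_eq_eq)
  qed
  have "R c ?b"
  proof (rule ccontr)
    assume "\<not> R c ?b"
    then have bc: "R ?b c" using R_edge[of c ?b] c(1) ci N by auto
    have ic: "R i c" using c(2) by simp
    \<comment> \<open>Whichever of \<open>i\<close> and \<open>?b\<close> is higher is adjacent to
      \<open>c\<close>, and the other one reuses its pebble on the way down. Adjacency of
      \<open>?b\<close> and \<open>c\<close> relies on \<open>c \<noteq> i\<close>.\<close>
    have "R i ?b \<or> R ?b i" using R_below[OF ic bc] .
    then show False
      using pebble[of i c ?b] pebble[of ?b c i] pib bc ic c(1) ci N by auto
  qed
  then show ?thesis using c(2) R_trans by blast
qed

text \<open>The vertex \<open>i + h + 1\<close> belongs to the next window and lies strictly below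
  \<open>Suc i\<close>, as \<open>h\<close> is positive.\<close>

lemma not_leftmost_last_Suc:
  assumes "i + h + 1 < N" and "\<not> leftmost_last i"
  shows "\<not> leftmost_last (Suc i)"
proof
  assume "leftmost_last (Suc i)"
  then have "R (i + h + 1) (Suc i)" by (simp add: leftmost_last_def)
  moreover have "R (Suc i) (i + h + 1)" using not_leftmost_last_next[OF assms] h_pos by simp
  ultimately show False using R_antisym h_pos by fastforce
qed

text \<open>From \<open>a\<close> on no complete window has its leftmost vertex last, so each vertex
  after the first \<open>h + 1\<close> comes below all earlier ones.\<close>

lemma chain_up:
  assumes "\<not> leftmost_last a" and "i < j" and "a \<le> i" and "j < N"
  shows "R i j \<or> R j i"
proof -
  have nt: "\<not> leftmost_last l" if "a \<le> l" "l + h < N" for l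
    using that by (induction l rule: dec_induct) (use assms(1) not_leftmost_last_Suc in auto)
  have "\<forall>i\<in>{a..<n}. R i n" if "a + h + 1 \<le> n" "n < N" for n
    using that
  proof (induction n rule: dec_induct)
    case base
    show ?case using not_leftmost_last_next[of a] nt[of a] base by auto
  next
    case (step n)
    \<comment> \<open>Start of the window that ends in \<open>n\<close>; thus \<open>n\<close>
      itself is put above \<open>Suc n\<close>.\<close>
    define l where "l = n - h"
    have l: "n = l + h" "a \<le> l" using step by (auto simp: l_def)
    have n: "\<forall>j\<in>{l..n}. R j (Suc n)" using not_leftmost_last_next[of l] nt[of l] l step.prems by auto
    then have "R n (Suc n)" using l by simp
    moreover have "\<forall>i\<in>{a..<n}. R i n" using step by simp
    ultimately show ?case using R_trans by (metis atLeastLessThan_iff less_SucE)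
  qed
  then show ?thesis
    using assms R_edge[of i j] by (cases "a + h + 1 \<le> j") auto
qed

text \<open>Before \<open>a\<close> the order runs against the path, since \<open>Suc i\<close> is
  above \<open>i\<close>. The \<open>h\<close> vertices from \<open>a\<close> on are pairwise
  adjacent.\<close>

lemma chain_down:
  assumes "\<And>i. i < a \<Longrightarrow> leftmost_last i" and "a + h \<le> N" and "i < j" and "j < a + h"
  shows "R i j \<or> R j i"
proof (cases "i < a")
  case True
  have "R j i"
    using \<open>i < j\<close> True
  proof (induction "j - i" arbitrary: i rule: less_induct)
    case less
    show ?case
    proof (cases "j \<le> i + h")
      case True
      then show ?thesis using assms(1)[OF less.prems(2)] less.prems by (simp add: leftmost_last_def)
    next
      case False
      \<comment> \<open>From \<open>i + h < j < a + h\<close> it follows that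
        \<open>Suc i < a\<close>, so the induction hypothesis applies.\<close>
      then have "R j (Suc i)" using less assms(4) h_pos by auto
      moreover have "R (Suc i) i"
        using assms(1)[OF less.prems(2)] h_pos by (simp add: leftmost_last_def)
      ultimately show ?thesis by (rule R_trans)
    qed
  qed
  then show ?thesis ..
next
  case False
  then show ?thesis using assms R_edge[of i j] by auto
qed

lemma two_chains:
  assumes "h \<le> N"
  obtains a where "a + h \<le> N"
    and "\<And>i j. i < a + h \<Longrightarrow> j < a + h \<Longrightarrow> R i j \<or> R j i"
    and "\<And>i j. a \<le> i \<Longrightarrow> a \<le> j \<Longrightarrow> i < N \<Longrightarrow> j < N \<Longrightarrow> R i j \<or> R j i"
proof -
  \<comment> \<open>No complete window starts at \<open>N - h\<close>, which therefore caps the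
    search; only \<open>h\<close> pairwise adjacent vertices remain from there on.\<close>
  define a where "a = (LEAST i. i = N - h \<or> \<not> leftmost_last i)"
  have a: "a = N - h \<or> \<not> leftmost_last a" unfolding a_def by (rule LeastI[of _ "N - h"]) simp
  have aN: "a \<le> N - h" unfolding a_def by (rule Least_le) simp
  have low: "leftmost_last i" if "i < a" for i using not_less_Least[OF that[unfolded a_def]] by simp
  have aN': "a + h \<le> N" using aN assms by simp
  show thesis
  proof (rule that[of a])
    show "a + h \<le> N" by (rule aN')
    show "R i j \<or> R j i" if "i < a + h" "j < a + h" for i j
      using chain_down[OF low aN', of i j] chain_down[OF low aN', of j i] that R_refl[of i] aN'
      by (cases i j rule: linorder_cases) auto
    show "R i j \<or> R j i" if "a \<le> i" "a \<le> j" "i < N" "j < N" for i j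
    proof (cases "a = N - h")
      case True
      then show ?thesis using R_edge that assms by auto
    next
      case False
      then have "\<not> leftmost_last a" using a by simp
      then show ?thesis
        using chain_up[of a i j] chain_up[of a j i] that R_refl[of i]
        by (cases i j rule: linorder_cases) auto
    qed
  qed
qed

end

text \<open>The two chains overlap in \<open>h\<close> vertices: their sizes \<open>a + h\<close>
  and \<open>N - a\<close> add up to \<open>N + h\<close> for every \<open>a\<close>.\<close>

lemma path_power_pebble_depth:
  assumes inj: "inj f" and "0 < h" and "h \<le> N"
    and pfc: "pebble_forest_cover (Suc h) (path_power f h N) r p"
  shows "N + h \<le> 2 * forest_height r"
proof -
  note [simp] = pverts_path_power[OF inj] parcs_path_power[OF inj]
  have rfor: "rooted_forest (f ` {..<N}) r"
    and edge: "\<And>u v. (u, v) \<in> parcs (path_power f h N) \<Longrightarrow> (u, v) \<in> r \<or> (v, u) \<in> r"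
    and rng: "p ` f ` {..<N} \<subseteq> {1..Suc h}"
    and peb: "\<And>u v w. (u, v) \<in> parcs (path_power f h N) \<Longrightarrow> (u, v) \<in> r \<Longrightarrow> (u, w) \<in> r \<Longrightarrow> u \<noteq> w \<Longrightarrow>
        (w, v) \<in> r \<Longrightarrow> p w \<noteq> p u"
    using pfc by (auto simp: pebble_forest_cover_def forest_cover_def)
  note rf = rooted_forestD[OF rfor]
  interpret path_power_cover h N "\<lambda>i j. (f i, f j) \<in> r" "\<lambda>i. p (f i)"
  proof
    show "0 < h" by fact
    show "(f i, f i) \<in> r" if "i < N" for i using rf(3) that by simp
    show "i = j" if "(f i, f j) \<in> r" "(f j, f i) \<in> r" for i j
      using that rf(4) inj by (auto dest: antisymD injD)
    show "(f i, f l) \<in> r" if "(f i, f j) \<in> r" "(f j, f l) \<in> r" for i j l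
      using that rf(5) by (auto dest: transD)
    show "(f i, f j) \<in> r \<or> (f j, f i) \<in> r" if "(f i, f l) \<in> r" "(f j, f l) \<in> r" for i j l
      using that by (rule rf(6))
    show "(f i, f j) \<in> r \<or> (f j, f i) \<in> r" if "i < N" "j < N" "i \<le> j + h" "j \<le> i + h" for i j
      using that edge[of "f i" "f j"] rf(3)[of "f i"] by (cases "i = j") auto
    show "p (f i) \<in> {1..Suc h}" if "i < N" for i
      using subsetD[OF rng] that by blast
    show "p (f w) \<noteq> p (f i)"
      if "i < N" "j < N" "i \<noteq> j" "i \<le> j + h" "j \<le> i + h" "(f i, f j) \<in> r" "(f i, f w) \<in> r"
        "i \<noteq> w" "(f w, f j) \<in> r" for i j w
      using that peb[of "f i" "f j" "f w"] inj by (auto dest: injD)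
  qed
  obtain a where a: "a + h \<le> N"
    and down: "\<And>i j. i < a + h \<Longrightarrow> j < a + h \<Longrightarrow> (f i, f j) \<in> r \<or> (f j, f i) \<in> r"
    and up: "\<And>i j. a \<le> i \<Longrightarrow> a \<le> j \<Longrightarrow> i < N \<Longrightarrow> j < N \<Longrightarrow> (f i, f j) \<in> r \<or> (f j, f i) \<in> r"
    using two_chains[OF assms(3)] by blast
  have "f ` {..<a + h} \<in> Chains r" "f ` {a..<N} \<in> Chains r"
    using down up by (auto simp: Chains_def)
  then have "card (f ` {..<a + h}) \<le> forest_height r" "card (f ` {a..<N}) \<le> forest_height r"
    using card_chain_le_forest_height[OF rfor] by auto
  moreover have "card (f ` A) = card A" for A
    using inj by (simp add: card_image inj_on_subset)
  ultimately show ?thesis using a by simp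
qed

section \<open>Strictness\<close>

text \<open>For the witness \<open>N + h = h * 2 ^ m\<close>, so \<open>2 * q < h * 2 ^ m\<close>
  says that the depth forced on pebble covers exceeds \<open>q\<close>, while
  \<open>h * m \<le> q\<close> keeps the treedepth within \<open>q\<close>. An infinite type has
  room for the witness.\<close>

lemma PFC_psubset:
  assumes "infinite (UNIV :: 'a set)" and "0 < h" and "0 < m" and "h * m \<le> q" and "2 * q < h * 2 ^ m"
  shows "(PFC (Suc h) q :: 'a pair_pre_digraph set) \<subset> TW h \<inter> TD q"
proof -
  obtain f :: "nat \<Rightarrow> 'a" where f: "inj f"
    using infinite_countable_subset[OF assms(1)] by blast
  define N where "N = h * (2 ^ m - 1)"
  have "(2::nat) ^ 1 \<le> 2 ^ m" using assms(3) by (intro power_increasing) auto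
  then have "2 ^ m = Suc (2 ^ m - 1)" "1 \<le> (2::nat) ^ m - 1" by simp_all
  then have N: "N + h = h * 2 ^ m" "h \<le> N"
    unfolding N_def by (metis add.commute mult_Suc_right) (use \<open>1 \<le> 2 ^ m - 1\<close> in simp)
  let ?G = "path_power f h N"
  have pg: "pair_graph ?G" by (rule pair_graph_path_power[OF f])
  obtain r p where "pebble_forest_cover (Suc h) ?G r p"
    using path_power_pebble_forest_cover[OF f] by blast
  then have "treewidth ?G \<le> h"
    using treewidth_le_of_pebble_forest_cover[OF _ pg] by fastforce
  moreover have "treedepth ?G \<le> q"
    using treedepth_path_power_le[OF f assms(2), of m] assms(4) by (simp add: N_def)
  ultimately have "?G \<in> TW h \<inter> TD q"
    using pg by (simp add: TW_def TD_def)
  moreover have "?G \<notin> PFC (Suc h) q"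
    using path_power_pebble_depth[OF f assms(2) N(2)] N(1) assms(5) by (fastforce simp: PFC_def)
  ultimately show ?thesis
    using PFC_subset[of "Suc h" q] by auto
qed

theorem theorem2:
  fixes q :: nat
  assumes "infinite (UNIV :: 'a set)"
    and "q \<ge> 3"
  shows "(\<forall>k :: nat. 2 \<le> k - 1 \<and> real (k - 1) \<le> real q / (3 + log 2 (real q)) \<longrightarrow>
            (PFC k q :: 'a pair_pre_digraph set) \<subset> TW (k - 1) \<inter> TD q)
         \<and> (PFC 2 q :: 'a pair_pre_digraph set) \<subset> TW 1 \<inter> TD q"
proof (intro conjI allI impI, elim conjE)
  fix k :: nat assume k: "2 \<le> k - 1" "real (k - 1) \<le> real q / (3 + log 2 (real q))"
  define h where "h = k - 1"
  \<comment> \<open>The largest number of levels for which \<open>h * m\<close> stays within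
    \<open>q\<close>.\<close>
  define m where "m = q div h"
  have h: "2 \<le> h" "k = Suc h" using k by (auto simp: h_def)
  have log: "0 \<le> log 2 (real q)" using assms(2) by simp
  then have "3 + log 2 (real q) \<le> real q / real h"
    using k(2) h(1) unfolding h_def[symmetric] by (simp add: field_simps)
  moreover have "real q / real h < real m + 1"
  proof -
    have "q < h + h * m"
      unfolding m_def using h(1) by (intro dividend_less_times_div) simp
    then have "real q < real h + real h * real m"
      by (metis of_nat_add of_nat_less_iff of_nat_mult)
    then show ?thesis using h(1) by (simp add: field_simps)
  qed
  \<comment> \<open>Rounding \<open>q / h\<close> down loses less than 1 of the constant 3; the
    remaining 2 yields \<open>4 * q < 2 ^ m\<close>.\<close>
  ultimately have m: "2 + log 2 (real q) < real m" by linarith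
  have "4 * real q = 2 powr (2 + log 2 (real q))"
    using assms(2) by (simp add: powr_add)
  also have "\<dots> < 2 powr real m"
    using m by simp
  also have "\<dots> = 2 ^ m"
    by (simp add: powr_realpow)
  finally have "4 * q < 2 ^ m"
    by (metis of_nat_less_iff of_nat_mult of_nat_numeral of_nat_power)
  also have "\<dots> \<le> h * 2 ^ m"
    using h(1) by simp
  finally have "2 * q < h * 2 ^ m" by simp
  moreover have "0 < m" using m log by linarith
  moreover have "h * m \<le> q" by (simp add: m_def)
  ultimately show "(PFC k q :: 'a pair_pre_digraph set) \<subset> TW (k - 1) \<inter> TD q"
    using PFC_psubset[OF assms(1), of h m q] h by simp
next
  \<comment> \<open>Here \<open>h = 1\<close> and \<open>m = q\<close>, so the witness is the path
    on \<open>2 ^ q - 1\<close> vertices. The inequality starts to hold at \<open>q = 3\<close>; for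
    \<open>q = 2\<close> both sides are 4.\<close>
  have "2 * q < 2 ^ q"
    using assms(2) by (induction q rule: dec_induct) auto
  then show "(PFC 2 q :: 'a pair_pre_digraph set) \<subset> TW 1 \<inter> TD q"
    using PFC_psubset[OF assms(1), of 1 q q] assms(2) by (simp add: numeral_2_eq_2)
qed

end
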